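(* Let $(X,\rho)$ be a compact metric space of diameter $1$ and let $T\colon X\to X$ be a continuous map such that $(X,T)$ has the partial specification property. Then for every $\varepsilon>0$ there exists an integer $M\ge 1$ such that each infinite $M$-spaced specification $\{T^{[a_i,b_i)}(x_i)\}_{i=1}^\infty$ can be $\varepsilon$-partially traced by a point $z\in X$.
   Context: Here $\mathbb{N}=\{0,1,2,\dots\}$. Specifications. For $x\in X$ and $a<b$ in $\mathbb{N}$, $T^{[a,b)}(x)$ denotes the orbit segment $T^a(x),T^{a+1}(x),\dots,T^{b-1}(x)$. For $M\in\mathbb{N}$, a finite collection $\{T^{[a_i,b_i)}(x_i)\}_{i=1}^r$ ($r\ge 1$, $x_i\in X$, $a_i,b_i\in\mathbb{N}$) is an $M$-spaced specification if $a_1<b_1<a_2<b_2<\dots<a_r<b_r$ and $a_i-b_{i-1}\ge M$ for $i=2,\dots,r$. An infinite $M$-spaced specification $\{T^{[a_i,b_i)}(x_i)\}_{i=1}^\infty$ is defined in the same way, with $a_1<b_1<a_2<b_2<\dots$ and $a_i-b_{i-1}\ge M$ for all $i\ge 2$. A (finite or infinite) specification is $\varepsilon$-partially traced by $z\in X$ if for every index $i$ we have $|\Lambda_i|/(b_i-a_i)>1-\varepsilon$, where $\Lambda_i=\{a_i\le n<b_i : \rho(T^n(z),T^n(x_i))<\varepsilon\}$. Partial specification. Let $P\subset\mathbb{N}$. $(X,T)$ has the partial specification property with periods $P$ if for every $\varepsilon>0$ there exist $M,N\in\mathbb{N}$ such that for every finite $M$-spaced specification $\{T^{[a_i,b_i)}(x_i)\}_{i=1}^r$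 and every $n\in P$ with $n\ge\max\{N,(1+\varepsilon)b_r\}$ there is a point $z\in X$ of period $n$ (i.e. $T^n(z)=z$) which $\varepsilon$-partially traces the specification. $(X,T)$ has the partial specification property if for every $c\in\mathbb{N}$ there is $P\subset c\mathbb{N}$ such that $(X,T)$ has the partial specification property with periods $P$.
   Formalization: In the partial specification property, the sets of periods P ⊂ cℕ are required to be infinite and c ranges over c ≥ 1; with finite or empty P the property holds in every system and the claim fails, e.g. for the identity on two points. *)

theory Defs
  imports "HOL-Analysis.Analysis"
begin

text \<open>
  The dynamical system is a subset X of a metric type (with metric \<^const>\<open>dist\<close>) together with
  a map T sending X to itself; the values of T outside X are irrelevant.

  A specification is given by functions a, b, x of the index. Indices start at 1; the index set I is
  \<^term>\<open>{1..r}\<close> for a finite specification and \<^term>\<open>{1::nat..}\<close> for an infinite one.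
\<close>

definition spaced_specification ::
  "'a set \<Rightarrow> nat \<Rightarrow> nat set \<Rightarrow> (nat \<Rightarrow> nat) \<Rightarrow> (nat \<Rightarrow> nat) \<Rightarrow> (nat \<Rightarrow> 'a) \<Rightarrow> bool" where
  "spaced_specification X M I a b x \<longleftrightarrow>
     (\<forall>i\<in>I. x i \<in> X \<and> a i < b i) \<and>
     (\<forall>i. i \<in> I \<and> Suc i \<in> I \<longrightarrow> b i < a (Suc i) \<and> a (Suc i) - b i \<ge> M)"

definition finite_specification ::
  "'a set \<Rightarrow> nat \<Rightarrow> nat \<Rightarrow> (nat \<Rightarrow> nat) \<Rightarrow> (nat \<Rightarrow> nat) \<Rightarrow> (nat \<Rightarrow> 'a) \<Rightarrow> bool" where
  "finite_specification X M r a b x \<longleftrightarrow> r \<ge> 1 \<and> spaced_specification X M {1..r} a b x"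

definition infinite_specification ::
  "'a set \<Rightarrow> nat \<Rightarrow> (nat \<Rightarrow> nat) \<Rightarrow> (nat \<Rightarrow> nat) \<Rightarrow> (nat \<Rightarrow> 'a) \<Rightarrow> bool" where
  "infinite_specification X M a b x \<longleftrightarrow> spaced_specification X M {1..} a b x"

definition partially_traced ::
  "('a::metric_space \<Rightarrow> 'a) \<Rightarrow> real \<Rightarrow> nat set \<Rightarrow> (nat \<Rightarrow> nat) \<Rightarrow> (nat \<Rightarrow> nat) \<Rightarrow> (nat \<Rightarrow> 'a) \<Rightarrow> 'a \<Rightarrow> bool"
where
  "partially_traced T \<epsilon> I a b x z \<longleftrightarrow>
     (\<forall>i\<in>I. real (card {n. a i \<le> n \<and> n < b i \<and> dist ((T ^^ n) z) ((T ^^ n) (x i)) < \<epsilon>})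
               / (real (b i) - real (a i)) > 1 - \<epsilon>)"

definition partial_specification_with_periods ::
  "'a::metric_space set \<Rightarrow> ('a \<Rightarrow> 'a) \<Rightarrow> nat set \<Rightarrow> bool" where
  "partial_specification_with_periods X T P \<longleftrightarrow>
     (\<forall>\<epsilon>>0. \<exists>M N. \<forall>r a b x. finite_specification X M r a b x \<longrightarrow>
        (\<forall>n\<in>P. n \<ge> N \<and> real n \<ge> (1 + \<epsilon>) * real (b r) \<longrightarrow>
           (\<exists>z\<in>X. (T ^^ n) z = z \<and> partially_traced T \<epsilon> {1..r} a b x z)))"

text \<open>
  The set of periods is required to be infinite: for a finite P the property with periods P holds in
  every system, since N may be chosen larger than all elements of P. Accordingly c ranges over the
  positive integers, as 0 has no infinite set of multiples.
\<close>

definition partial_specification_property ::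
  "'a::metric_space set \<Rightarrow> ('a \<Rightarrow> 'a) \<Rightarrow> bool" where
  "partial_specification_property X T \<longleftrightarrow>
     (\<forall>c>0. \<exists>P. infinite P \<and> P \<subseteq> {n. c dvd n} \<and> partial_specification_with_periods X T P)"

end

theory Submission
  imports Defs
begin

text \<open>
  Trace every initial part of the infinite specification by a (periodic) point with accuracy
  \<open>\<epsilon> / 2\<close> and pass to a limit point. Each segment lives in a finite time window, on which the orbits
  of the approximating points converge uniformly, so every segment keeps all of its good times at
  the cost of replacing \<open>\<epsilon> / 2\<close> by \<open>\<epsilon>\<close>.
\<close>

lemma funpow_closed:
  assumes "T ` X \<subseteq> X" "z \<in> X"
  shows "(T ^^ n) z \<in> X"
  using assms by (induction n) auto

lemma continuous_on_funpow:
  fixes T :: "'a::topological_space \<Rightarrow> 'a"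
  assumes "continuous_on X T" "T ` X \<subseteq> X"
  shows "continuous_on X (T ^^ n)"
proof (induction n)
  case 0
  show ?case by (simp add: id_def)
next
  case (Suc n)
  have "(T ^^ n) ` X \<subseteq> X"
    using funpow_closed[OF assms(2)] by auto
  then have "continuous_on ((T ^^ n) ` X) T"
    using assms(1) continuous_on_subset by blast
  from continuous_on_compose[OF Suc this] show ?case
    by (simp add: comp_def)
qed

text \<open>The index \<open>i\<close> constrains only the finitely many times in
  \<open>[a i, b i)\<close>, so one point \<open>w k\<close> close enough to \<open>z\<close> along
  that window transfers its good times to \<open>z\<close>. Tracing is assumed for each
  \<open>i\<close> separately and only eventually in \<open>k\<close>: the points to be used trace
  longer and longer initial parts, so the threshold has to depend on \<open>i\<close>.\<close>

lemma partially_traced_limit: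
  fixes T :: "'a::metric_space \<Rightarrow> 'a"
  assumes cont: "continuous_on X T" and inv: "T ` X \<subseteq> X"
    and w: "\<And>k. w k \<in> X" "w \<longlonglongrightarrow> z" and z: "z \<in> X"
    and lt: "\<delta> < \<epsilon>" and ab: "\<And>i. i \<in> I \<Longrightarrow> a i < b i"
    and traced: "\<And>i. i \<in> I \<Longrightarrow> \<forall>\<^sub>F k in sequentially. partially_traced T \<delta> {i} a b x (w k)"
  shows "partially_traced T \<epsilon> I a b x z"
  unfolding partially_traced_def
proof
  fix i assume i: "i \<in> I"
  let ?good = "\<lambda>e y. {n. a i \<le> n \<and> n < b i \<and> dist ((T ^^ n) y) ((T ^^ n) (x i)) < e}"
  let ?len = "real (b i) - real (a i)"
  have "\<forall>\<^sub>F k in sequentially. dist ((T ^^ n) (w k)) ((T ^^ n) z) < \<epsilon> - \<delta>" for n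
  proof (rule tendstoD)
    show "(\<lambda>k. (T ^^ n) (w k)) \<longlonglongrightarrow> (T ^^ n) z"
      using continuous_on_tendsto_compose[OF continuous_on_funpow[OF cont inv] w(2) z] w(1)
      by simp
  qed (use lt in simp)
  \<comment> \<open>Finiteness of the window turns convergence at each time into a single threshold
    for all times. The bound \<open>\<epsilon> - \<delta>\<close> is the slack that the triangle
    inequality spends below.\<close>
  then have "\<forall>\<^sub>F k in sequentially.
      \<forall>n\<in>{a i..<b i}. dist ((T ^^ n) (w k)) ((T ^^ n) z) < \<epsilon> - \<delta>"
    by (simp add: eventually_ball_finite)
  from eventually_conj[OF this traced[OF i]] obtain k where
    close: "\<forall>n\<in>{a i..<b i}. dist ((T ^^ n) (w k)) ((T ^^ n) z) < \<epsilon> - \<delta>" and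
    tr: "partially_traced T \<delta> {i} a b x (w k)"
    using eventually_happens'[OF sequentially_bot] by blast
  have "?good \<delta> (w k) \<subseteq> ?good \<epsilon> z"
  proof (rule Collect_mono, rule impI, elim conjE)
    fix n assume n: "a i \<le> n" "n < b i" "dist ((T ^^ n) (w k)) ((T ^^ n) (x i)) < \<delta>"
    have "dist ((T ^^ n) (w k)) ((T ^^ n) z) < \<epsilon> - \<delta>"
      using close n by simp
    with n show "a i \<le> n \<and> n < b i \<and> dist ((T ^^ n) z) ((T ^^ n) (x i)) < \<epsilon>"
      using dist_triangle3[of "(T ^^ n) z" "(T ^^ n) (x i)" "(T ^^ n) (w k)"] by simp
  qed
  then have "card (?good \<delta> (w k)) \<le> card (?good \<epsilon> z)"
    by (intro card_mono) auto
  then have "real (card (?good \<delta> (w k))) / ?len \<le> real (card (?good \<epsilon> z)) / ?len"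
    using ab[OF i] by (simp add: divide_right_mono)
  moreover have "1 - \<delta> < real (card (?good \<delta> (w k))) / ?len"
    using tr by (simp add: partially_traced_def)
  ultimately show "1 - \<epsilon> < real (card (?good \<epsilon> z)) / ?len"
    using lt by linarith
qed

theorem proposition3p8:
  fixes X :: "'a::metric_space set" and T :: "'a \<Rightarrow> 'a" and \<epsilon> :: real
  assumes "compact X" and "diameter X = 1"
    and "continuous_on X T" and "T ` X \<subseteq> X"
    and "partial_specification_property X T"
    and "\<epsilon> > 0"
  shows "\<exists>M::nat. M \<ge> 1 \<and>
           (\<forall>a b x. infinite_specification X M a b x \<longrightarrow>
              (\<exists>z\<in>X. partially_traced T \<epsilon> {1..} a b x z))"
proof -
  \<comment> \<open>Taking \<open>c = 1\<close> is enough: the periods must be arbitrarily large,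
    and no divisibility is wanted.\<close>
  obtain P where P: "infinite P" "partial_specification_with_periods X T P"
    using assms(5) unfolding partial_specification_property_def by (meson zero_less_one)
  obtain M N where MN: "\<And>r a b x n. finite_specification X M r a b x \<Longrightarrow> n \<in> P \<Longrightarrow> n \<ge> N \<Longrightarrow>
      real n \<ge> (1 + \<epsilon> / 2) * real (b r) \<Longrightarrow>
      \<exists>z\<in>X. (T ^^ n) z = z \<and> partially_traced T (\<epsilon> / 2) {1..r} a b x z"
    using P(2) \<open>\<epsilon> > 0\<close> half_gt_zero unfolding partial_specification_with_periods_def by meson
  \<comment> \<open>The gap \<open>max 1 M\<close> meets the demand for a positive integer and still
    gives \<open>M\<close>-spaced initial parts.\<close>
  have "\<exists>z\<in>X. partially_traced T \<epsilon> {1..} a b x z"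
    if inf: "infinite_specification X (max 1 M) a b x" for a b x
  proof -
    \<comment> \<open>\<open>Suc r\<close> keeps the initial part nonempty, as a finite
      specification requires.\<close>
    have "\<exists>z\<in>X. partially_traced T (\<epsilon> / 2) {1..Suc r} a b x z" for r
    proof -
      have fin: "finite_specification X M (Suc r) a b x"
        using inf unfolding finite_specification_def infinite_specification_def
          spaced_specification_def by auto
      \<comment> \<open>\<open>P\<close> is unbounded, so some period exceeds \<open>N\<close> as
        well as the bound coming from the end \<open>b (Suc r)\<close> of the initial part.\<close>
      obtain n where n: "n \<in> P" "n \<ge> max N (nat \<lceil>(1 + \<epsilon> / 2) * real (b (Suc r))\<rceil>)"
        using P(1) infinite_nat_iff_unbounded_le by blast
      then have "(1 + \<epsilon> / 2) * real (b (Suc r)) \<le> real n"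
        by linarith
      with MN[OF fin] n show ?thesis by force
    qed
    then obtain z where z: "\<And>r. z r \<in> X" "\<And>r. partially_traced T (\<epsilon> / 2) {1..Suc r} a b x (z r)"
      by metis
    obtain l s where l: "l \<in> X" "strict_mono s" "(z \<circ> s) \<longlonglongrightarrow> l"
      using \<open>compact X\<close> z(1) unfolding compact_def by meson
    have "partially_traced T \<epsilon> {1..} a b x l"
    proof (rule partially_traced_limit[OF assms(3,4), where w = "z \<circ> s" and \<delta> = "\<epsilon> / 2"])
      fix i :: nat assume i: "i \<in> {1..}"
      show "a i < b i"
        using inf i unfolding infinite_specification_def spaced_specification_def by blast
      \<comment> \<open>Since \<open>i \<le> k \<le> s k\<close>, the segment \<open>i\<close>
        belongs to the initial part traced by \<open>z (s k)\<close>.\<close>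
      have "partially_traced T (\<epsilon> / 2) {i} a b x ((z \<circ> s) k)" if "i \<le> k" for k
        using z(2)[of "s k"] i that seq_suble[OF l(2), of k]
        unfolding partially_traced_def by auto
      then show "\<forall>\<^sub>F k in sequentially. partially_traced T (\<epsilon> / 2) {i} a b x ((z \<circ> s) k)"
        by (rule eventually_sequentiallyI)
    qed (use z l \<open>\<epsilon> > 0\<close> in auto)
    with l(1) show ?thesis by blast
  qed
  then show ?thesis
    by (intro exI[of _ "max 1 M"]) auto
qed

end
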